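(* Let $m \ge 0$ be an integer, let $k = 4m+3$, and let $f(x,z) = \lfloor \frac{x+z}{k} \rfloor$ for non-negative integers $x,z$. Consider the impartial game whose positions are triples $(x,y,z)$ of non-negative integers with $y \le f(x,z)$, in which a move from $(x,y,z)$ goes to one of the following positions: (i) $(u, \min(f(u,z),y), z)$ for some integer $0 \le u < x$; (ii) $(x, v, z)$ for some integer $0 \le v < y$; (iii) $(x, \min(y, f(x,w)), w)$ for some integer $0 \le w < z$. The players alternate moves, and the player who cannot move (this happens exactly at $(0,0,0)$) loses. Then the position $(x,y,z)$ is a $\mathcal{P}$-position if and only if $x \oplus y \oplus z = 0$.
   Context: This game models the three-dimensional chocolate bar $CB(f,x,y,z)$: for $0\le u\le x$, $0\le w\le z$ the column at $(u,w)$ has height $\min(f(u,w),y)+1$, there is a bitter cube at $(0,0)$ at the bottom, players cut the bar along grooves and eat the piece without the bitter cube, and the player who leaves the opponent only the bitter cube wins; the moves above describe the resulting coordinates. $\oplus$ denotes nim-sum (bitwise XOR of binary expansions). A $\mathcal{P}$-position is a position from which the previous player (the player who just moved) can force a win. *)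

theory Defs
  imports Main
begin

text \<open>
  Normal play on an arbitrary move relation. \<open>P_position\<close> says that the player who has just moved
  can force a win, \<open>N_position\<close> that the player about to move can. The least fixed point expresses
  that the win is reached after finitely many moves; a player who cannot move loses because the
  premise of \<open>P_position\<close> is then vacuous.
\<close>

inductive P_position :: "('a \<Rightarrow> 'a \<Rightarrow> bool) \<Rightarrow> 'a \<Rightarrow> bool"
  and N_position :: "('a \<Rightarrow> 'a \<Rightarrow> bool) \<Rightarrow> 'a \<Rightarrow> bool"
  for move :: "'a \<Rightarrow> 'a \<Rightarrow> bool"
where
  P_positionI: "(\<And>q. move p q \<Longrightarrow> N_position move q) \<Longrightarrow> P_position move p"
| N_positionI: "move p q \<Longrightarrow> P_position move q \<Longrightarrow> N_position move p"

definition chocolate_positions :: "(nat \<Rightarrow> nat \<Rightarrow> nat) \<Rightarrow> (nat \<times> nat \<times> nat) set" where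
  "chocolate_positions f = {(x, y, z). y \<le> f x z}"

inductive chocolate_move ::
  "(nat \<Rightarrow> nat \<Rightarrow> nat) \<Rightarrow> nat \<times> nat \<times> nat \<Rightarrow> nat \<times> nat \<times> nat \<Rightarrow> bool"
  for f :: "nat \<Rightarrow> nat \<Rightarrow> nat"
where
  cut_x: "u < x \<Longrightarrow> chocolate_move f (x, y, z) (u, min (f u z) y, z)"
| cut_y: "v < y \<Longrightarrow> chocolate_move f (x, y, z) (x, v, z)"
| cut_z: "w < z \<Longrightarrow> chocolate_move f (x, y, z) (x, min y (f x w), w)"

text \<open>
  Positions are closed under moves, so it is harmless that the move relation is also defined on
  triples that are not positions.
\<close>

lemma chocolate_move_closed:
  assumes "p \<in> chocolate_positions f" and "chocolate_move f p q"
  shows "q \<in> chocolate_positions f"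
  using assms(2,1) by cases (auto simp: chocolate_positions_def)

lemma chocolate_no_move_iff:
  "(\<nexists>q. chocolate_move f (x, y, z) q) \<longleftrightarrow> (x, y, z) = (0, 0, 0)"
proof
  assume none: "\<nexists>q. chocolate_move f (x, y, z) q"
  show "(x, y, z) = (0, 0, 0)"
    using none cut_x[of 0 x f y z] cut_y[of 0 y f x z] cut_z[of 0 z f x y] by auto
next
  assume "(x, y, z) = (0, 0, 0)"
  then show "\<nexists>q. chocolate_move f (x, y, z) q"
    by (auto elim: chocolate_move.cases)
qed

end

theory Submission imports Defs begin

text \<open>
  Write \<open>k = 2 c + 1\<close>, so that \<open>c\<close> is odd. Since \<open>(y \<oplus> z) + z = y + 2 a\<close>, where \<open>a\<close> consists of the
  bits of \<open>z\<close> that are not in \<open>y\<close>, the triple \<open>(y \<oplus> z, y, z)\<close> is a position iff \<open>c y \<le> a\<close>.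
  For fixed \<open>z\<close> this condition is downward closed in \<open>y\<close>: comparing \<open>v < y\<close> above the highest
  bit in which they differ, \<open>c y\<close> is odd and \<open>a\<close> is even, which leaves room for the strict inequality
  \<open>v < f (v \<oplus> z) z\<close>. Hence \<open>v = f (v \<oplus> z) z\<close> holds only for the largest \<open>v\<close> satisfying
  the condition, and it does hold for that \<open>v\<close>. So a cut that lowers \<open>y\<close> never leads from nim-sum
  zero to nim-sum zero, and whenever the ordinary nim move is spoilt because the cut lowers
  \<open>y\<close>, cutting down to this largest \<open>v\<close> is a winning move instead.
\<close>

section \<open>Normal play\<close>

lemma P_N_exclusive:
  "P_position move p \<Longrightarrow> \<not> N_position move p"
  "N_position move q \<Longrightarrow> \<not> P_position move q"
proof (induction rule: P_position_N_position.inducts)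
  case (P_positionI p)
  then show ?case by (auto elim: N_position.cases)
next
  case (N_positionI p q)
  then show ?case by (auto elim: P_position.cases)
qed

text \<open>Induction on \<open>rank\<close> sorts each position of \<open>S\<close> into
  \<open>P_position\<close> or \<open>N_position\<close> according to \<open>K\<close>;
  exclusiveness then gives the equivalence.\<close>

lemma P_position_iff_kernel:
  fixes rank :: "'a \<Rightarrow> nat"
  assumes closed: "\<And>p q. p \<in> S \<Longrightarrow> move p q \<Longrightarrow> q \<in> S"
    and decr: "\<And>p q. p \<in> S \<Longrightarrow> move p q \<Longrightarrow> rank q < rank p"
    and stable: "\<And>p q. p \<in> S \<Longrightarrow> move p q \<Longrightarrow> K p \<Longrightarrow> \<not> K q"
    and absorbing: "\<And>p. p \<in> S \<Longrightarrow> \<not> K p \<Longrightarrow> \<exists>q. move p q \<and> K q"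
    and "p \<in> S"
  shows "P_position move p \<longleftrightarrow> K p"
proof -
  have "if K p then P_position move p else N_position move p"
    using \<open>p \<in> S\<close>
  proof (induction p rule: measure_induct_rule[of rank])
    case (less p)
    have IH: "if K q then P_position move q else N_position move q" if "move p q" for q
      using less that closed decr by blast
    show ?case
    proof (cases "K p")
      case True
      then have "N_position move q" if "move p q" for q
        using IH[OF that] stable[OF less.prems that] by simp
      with True show ?thesis by (simp add: P_positionI)
    next
      case False
      then obtain q where "move p q" "K q"
        using absorbing less.prems by blast
      with IH have "P_position move q" by fastforce
      with False \<open>move p q\<close> show ?thesis by (auto intro: N_positionI)
    qed
  qed
  then show ?thesis
    using P_N_exclusive by (metis (full_types))
qed

section \<open>Nim-sums\<close>

text \<open>The bits of \<open>z\<close> not in \<open>y\<close>; the complement is not available on \<open>nat\<close>.\<close>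

definition nat_and_not :: "nat \<Rightarrow> nat \<Rightarrow> nat" where
  "nat_and_not z y = Bit_Operations.and z (Bit_Operations.xor y z)"

lemma nat_and_not_0_right [simp]: "nat_and_not z 0 = z"
  by (simp add: nat_and_not_def)

lemma xor_nat_rec:
  "Bit_Operations.xor (x::nat) y =
     (x mod 2 + y mod 2) mod 2 + 2 * Bit_Operations.xor (x div 2) (y div 2)"
  by (subst xor_nat_unfold) auto

lemma nat_and_not_rec:
  "nat_and_not z y = z mod 2 * (1 - y mod 2) + 2 * nat_and_not (z div 2) (y div 2)"
proof -
  have "(z::nat) mod 2 * ((y mod 2 + z mod 2) mod 2) = z mod 2 * (1 - y mod 2)"
    by (cases "even z"; cases "even y") (auto simp: even_iff_mod_2_eq_zero odd_iff_mod_2_eq_one)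
  moreover have "Bit_Operations.xor y z mod 2 = (y mod 2 + z mod 2) mod 2"
    by (subst xor_nat_rec) simp
  moreover have "Bit_Operations.xor y z div 2 = Bit_Operations.xor (y div 2) (z div 2)"
    by (subst xor_nat_rec) simp
  ultimately show ?thesis
    unfolding nat_and_not_def by (subst and_nat_unfold) auto
qed

text \<open>Bit by bit: a bit of \<open>y\<close> counts once on the left, inside \<open>z\<close>
  if \<open>z\<close> has it and inside the nim-sum otherwise; a bit of \<open>z\<close> alone
  counts twice.\<close>

lemma xor_add_eq: "Bit_Operations.xor y z + z = y + 2 * nat_and_not z y"
proof (induction y arbitrary: z rule: less_induct)
  case (less y)
  show ?case
  proof (cases "y = 0")
    case False
    then have IH: "Bit_Operations.xor (y div 2) (z div 2) + z div 2 =
        y div 2 + 2 * nat_and_not (z div 2) (y div 2)"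
      by (intro less.IH) auto
    have y: "y = y mod 2 + 2 * (y div 2)" and z: "z = z mod 2 + 2 * (z div 2)"
      by simp_all
    have parity: "(y mod 2 + z mod 2) mod 2 + z mod 2 = y mod 2 + 2 * (z mod 2 * (1 - y mod 2))"
      by (cases "even z"; cases "even y") (auto simp: even_iff_mod_2_eq_zero odd_iff_mod_2_eq_one)
    show ?thesis
      using IH parity y z xor_nat_rec[of y z] nat_and_not_rec[of z y] by linarith
  qed simp
qed

text \<open>If the halves have nonzero nim-sum, a strict inequality between halves lifts. Otherwise
  only the last bits are unbalanced, and some odd number drops to an even one with the same
  half.\<close>

lemma nim_reducing_move_exists:
  fixes x y z :: nat
  assumes "Bit_Operations.xor (Bit_Operations.xor x y) z \<noteq> 0"
  shows "Bit_Operations.xor y z < x \<or> Bit_Operations.xor x z < y \<or> Bit_Operations.xor x y < z"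
  using assms
proof (induction "x + y + z" arbitrary: x y z rule: less_induct)
  case less
  let ?x = "x div 2" and ?y = "y div 2" and ?z = "z div 2"
  have div: "Bit_Operations.xor a b div 2 = Bit_Operations.xor (a div 2) (b div 2)"
    and mod: "Bit_Operations.xor a b mod 2 = (a mod 2 + b mod 2) mod 2" for a b :: nat
    by (subst xor_nat_rec; simp)+
  have lift: "a < b" if "a div 2 < b div 2" for a b :: nat
    using that by linarith
  show ?case
  proof (cases "Bit_Operations.xor (Bit_Operations.xor ?x ?y) ?z = 0")
    case False
    then have "?x + ?y + ?z < x + y + z"
      by (cases "x = 0"; cases "y = 0"; cases "z = 0")
        (auto intro!: add_less_le_mono add_le_less_mono add_less_mono)
    from less.hyps[OF this False] show ?thesis
      by (auto simp: div[symmetric] intro: lift)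
  next
    case True
    have half: "Bit_Operations.xor ?y ?z = ?x" "Bit_Operations.xor ?x ?z = ?y" "Bit_Operations.xor ?x ?y = ?z"
      using True by (metis xor.assoc xor.commute xor.left_neutral xor_self_eq)+
    have "Bit_Operations.xor (Bit_Operations.xor x y) z mod 2 \<noteq> 0"
      using less.prems True div by (metis add.right_neutral div_mult_mod_eq mult_zero_left)
    then have odd: "odd (x + y + z)"
      by (simp add: mod even_iff_mod_2_eq_zero mod_simps)
    have less: "a < b" if "a div 2 = b div 2" "a mod 2 = 0" "b mod 2 = 1" for a b :: nat
      using that by (metis add.right_neutral div_mult_mod_eq less_add_one)
    consider "odd x" "even (y + z)" | "odd y" "even (x + z)" | "odd z" "even (x + y)"
      using odd by fastforce
    then show ?thesis
    proof cases
      case 1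
      then have "Bit_Operations.xor y z < x"
        by (intro less) (auto simp: div half mod mod_simps odd_iff_mod_2_eq_one even_iff_mod_2_eq_zero)
      then show ?thesis by simp
    next
      case 2
      then have "Bit_Operations.xor x z < y"
        by (intro less) (auto simp: div half mod mod_simps odd_iff_mod_2_eq_one even_iff_mod_2_eq_zero)
      then show ?thesis by simp
    next
      case 3
      then have "Bit_Operations.xor x y < z"
        by (intro less) (auto simp: div half mod mod_simps odd_iff_mod_2_eq_one even_iff_mod_2_eq_zero)
      then show ?thesis by simp
    qed
  qed
qed

section \<open>Positions with nim-sum zero\<close>

lemma nat_and_not_downward:
  assumes "odd c" "v < y" "c * y \<le> nat_and_not z y"
  shows "c * (v + 1) < nat_and_not z v"
  using assms(2,3)
proof (induction y arbitrary: v z rule: less_induct)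
  case (less y)
  have y: "y = y mod 2 + 2 * (y div 2)" and v: "v = v mod 2 + 2 * (v div 2)"
    by simp_all
  have rec_v: "2 * nat_and_not (z div 2) (v div 2) \<le> nat_and_not z v"
    using nat_and_not_rec[of z v] by linarith
  show ?case
  proof (cases "v div 2 < y div 2")
    case True
    \<comment> \<open>A last bit adds at most 1, too little to bridge a gap between even numbers, so
      the hypothesis passes to the halves.\<close>
    have "z mod 2 * (1 - y mod 2) \<le> 1"
      by (cases "even z"; cases "even y") (auto simp: even_iff_mod_2_eq_zero odd_iff_mod_2_eq_one)
    then have "nat_and_not z y \<le> 1 + 2 * nat_and_not (z div 2) (y div 2)"
      using nat_and_not_rec[of z y] by linarith
    moreover have "2 * (c * (y div 2)) \<le> c * y"
      unfolding mult.left_commute[of 2] by (intro mult_le_mono2) simp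
    ultimately have "c * (y div 2) \<le> nat_and_not (z div 2) (y div 2)"
      using less.prems(2) by linarith
    with True less.prems have "c * (v div 2 + 1) < nat_and_not (z div 2) (v div 2)"
      by (intro less.IH) auto
    moreover have "c * (v + 1) \<le> c * (2 * (v div 2 + 1))"
      by (intro mult_le_mono2) presburger
    ultimately show ?thesis
      using rec_v by (simp add: mult.left_commute)
  next
    case False
    with \<open>v < y\<close> have div: "v div 2 = y div 2" by (meson div_le_mono less_imp_le_nat nat_less_le)
    with \<open>v < y\<close> y v have y1: "y mod 2 = 1" "y = v + 1"
      by linarith+
    have "nat_and_not z y = 2 * nat_and_not (z div 2) (v div 2)"
      using nat_and_not_rec[of z y] y1(1) div by simp
    \<comment> \<open>Oddness of \<open>c\<close> enters here: \<open>c * y\<close> cannot equal an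
      even number, so the hypothesis is strict.\<close>
    moreover have "odd (c * y)"
      using \<open>odd c\<close> y1(1) by (simp add: odd_iff_mod_2_eq_one)
    ultimately have "c * y \<noteq> nat_and_not z y"
      by (metis dvd_triv_left)
    with less.prems(2) \<open>nat_and_not z y = _\<close> rec_v y1(2) show ?thesis by simp
  qed
qed

text \<open>Gives the upper bound for a fixed point just below a failing \<open>v + 1\<close>. For
  even \<open>v\<close> the two values of \<open>nat_and_not\<close> differ by at most 1; for odd
  \<open>v\<close> both bounds are even and the claim reduces to the halves.\<close>

lemma nat_and_not_boundary:
  assumes "nat_and_not z (v + 1) < c * (v + 1)"
  shows "nat_and_not z v \<le> c * (v + 1)"
  using assms
proof (induction v arbitrary: z rule: less_induct)
  case (less v)
  have z: "z mod 2 \<le> 1" by simp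
  show ?case
  proof (cases "even v")
    case True
    then have "(v + 1) mod 2 = 1" "v mod 2 = 0" "(v + 1) div 2 = v div 2"
      by presburger+
    then show ?thesis
      using less.prems z nat_and_not_rec[of z v] nat_and_not_rec[of z "v + 1"] by simp
  next
    case False
    then have v: "(v + 1) mod 2 = 0" "v mod 2 = 1" "(v + 1) div 2 = v div 2 + 1"
        "v + 1 = 2 * (v div 2 + 1)" "v div 2 < v"
      by presburger+
    have c: "c * (v + 1) = 2 * (c * (v div 2 + 1))"
      by (subst v(4)) (simp only: mult.left_commute)
    have "nat_and_not (z div 2) (v div 2 + 1) < c * (v div 2 + 1)"
      using less.prems nat_and_not_rec[of z "v + 1"] unfolding v(1,3) c by linarith
    from less.IH[OF v(5) this] show ?thesis
      using nat_and_not_rec[of z v] unfolding v(2) c by simp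
  qed
qed

lemma le_div_iff_nat_and_not:
  fixes c k y z :: nat
  assumes "k = 2 * c + 1"
  shows "y \<le> (Bit_Operations.xor y z + z) div k \<longleftrightarrow> c * y \<le> nat_and_not z y"
proof -
  have "y \<le> (Bit_Operations.xor y z + z) div k \<longleftrightarrow> y * k \<le> y + 2 * nat_and_not z y"
    using assms by (simp add: xor_add_eq less_eq_div_iff_mult_less_eq)
  also have "y * k = y + 2 * (c * y)"
    by (simp add: assms)
  finally show ?thesis by simp
qed

lemma div_le_iff_nat_and_not:
  fixes c k y z :: nat
  assumes "k = 2 * c + 1"
  shows "(Bit_Operations.xor y z + z) div k \<le> y \<longleftrightarrow> nat_and_not z y \<le> c * (y + 1)"
proof -
  have "(Bit_Operations.xor y z + z) div k \<le> y \<longleftrightarrow> (Bit_Operations.xor y z + z) div k < y + 1"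
    by linarith
  also have "\<dots> \<longleftrightarrow> y + 2 * nat_and_not z y < (y + 1) * k"
    using assms by (simp add: xor_add_eq div_less_iff_less_mult)
  \<comment> \<open>The trailing 1 turns the strict bound on an even number into a non-strict
    one.\<close>
  also have "(y + 1) * k = y + 2 * (c * (y + 1)) + 1"
    by (simp add: assms algebra_simps)
  finally show ?thesis by linarith
qed

lemma xor_div_downward:
  fixes c k v y z :: nat
  assumes "k = 2 * c + 1" "odd c" "v < y" "y \<le> (Bit_Operations.xor y z + z) div k"
  shows "v < (Bit_Operations.xor v z + z) div k"
  using nat_and_not_downward[OF assms(2,3)] assms(4)
    le_div_iff_nat_and_not[OF assms(1)] div_le_iff_nat_and_not[OF assms(1)]
  by (meson not_le)

lemma xor_div_fixpoint_exists:
  fixes c k y z :: nat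
  assumes "k = 2 * c + 1" "odd c" "(Bit_Operations.xor y z + z) div k < y"
  shows "\<exists>v<y. v = (Bit_Operations.xor v z + z) div k"
proof -
  let ?Q = "\<lambda>v. v \<le> (Bit_Operations.xor v z + z) div k"
  \<comment> \<open>The fixed point is the predecessor of the least failure, which is positive
    because \<open>?Q 0\<close> holds.\<close>
  define n where "n = (LEAST n. \<not> ?Q n)"
  have "\<not> ?Q y" using assms(3) by simp
  then have n: "\<not> ?Q n" "n \<le> y"
    unfolding n_def by (rule LeastI, rule Least_le)
  then obtain v where v: "n = v + 1"
    by (cases n) auto
  then have "?Q v"
    using not_less_Least[of v "\<lambda>n. \<not> ?Q n"] by (simp add: n_def[symmetric])
  moreover have "nat_and_not z (v + 1) < c * (v + 1)"
    using n(1) le_div_iff_nat_and_not[OF assms(1)] v by (meson not_le)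
  then have "(Bit_Operations.xor v z + z) div k \<le> v"
    using nat_and_not_boundary div_le_iff_nat_and_not[OF assms(1)] by blast
  ultimately show ?thesis
    using n(2) v by (intro exI[of _ v]) simp
qed

section \<open>The chocolate game\<close>

lemma xor_eq_0_iff_nat: "Bit_Operations.xor a b = 0 \<longleftrightarrow> a = b" for a b :: nat
  by (metis xor.assoc xor.right_neutral xor_self_eq xor.left_neutral)

text \<open>If the cut keeps \<open>y\<close>, nim-sum zero would force \<open>u = x\<close>; if it
  lowers \<open>y\<close>, the new value would be a fixed point below \<open>y\<close>, against
  \<open>xor_div_downward\<close>.\<close>

lemma cut_leaves_nim_zero:
  fixes c k u x y z :: nat
  assumes k: "k = 2 * c + 1" "odd c"
    and pos: "y \<le> (x + z) div k" and "x = Bit_Operations.xor y z" and "u < x"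
  shows "u \<noteq> Bit_Operations.xor (min ((u + z) div k) y) z"
proof
  assume u: "u = Bit_Operations.xor (min ((u + z) div k) y) z"
  show False
  proof (cases "(u + z) div k < y")
    case True
    with u have "u = Bit_Operations.xor ((u + z) div k) z" by simp
    with xor_div_downward[OF k True, of z] pos assms(4) show False by simp
  next
    case False
    with u assms(4,5) show False by simp
  qed
qed

lemma cut_to_nim_zero_exists:
  fixes c k x y z :: nat
  assumes k: "k = 2 * c + 1" "odd c"
    and pos: "y \<le> (x + z) div k" and "Bit_Operations.xor y z < x"
  shows "\<exists>u<x. u = Bit_Operations.xor (min ((u + z) div k) y) z"
proof (cases "(Bit_Operations.xor y z + z) div k < y")
  case True
  from xor_div_fixpoint_exists[OF k this]
  obtain v where v: "v < y" "v = (Bit_Operations.xor v z + z) div k" by blast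
  \<comment> \<open>Otherwise monotonicity of the quotient would give
    \<open>y \<le> v\<close>.\<close>
  have "Bit_Operations.xor v z < x"
  proof (rule ccontr)
    assume "\<not> ?thesis"
    then have "(x + z) div k \<le> (Bit_Operations.xor v z + z) div k"
      by (intro div_le_mono) simp
    with v pos show False by simp
  qed
  with v show ?thesis
    by (intro exI[of _ "Bit_Operations.xor v z"]) simp
next
  case False
  with assms(4) show ?thesis
    by (intro exI[of _ "Bit_Operations.xor y z"]) (simp add: min_absorb2)
qed

theorem theorem2p11:
  fixes m k :: nat and f :: "nat \<Rightarrow> nat \<Rightarrow> nat" and x y z :: nat
  assumes "k = 4 * m + 3"
    and "f = (\<lambda>x z. (x + z) div k)"
    and "(x, y, z) \<in> chocolate_positions f"
  shows "P_position (chocolate_move f) (x, y, z) \<longleftrightarrow> Bit_Operations.xor (Bit_Operations.xor x y) z = 0"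
proof -
  \<comment> \<open>Residue 3 modulo 4 is what makes \<open>c = 2 * m + 1\<close> odd.\<close>
  have k: "k = 2 * (2 * m + 1) + 1" "odd (2 * m + 1)"
    using assms(1) by simp_all
  have f: "f a b = (a + b) div k" for a b
    by (simp add: assms(2))
  define K :: "nat \<times> nat \<times> nat \<Rightarrow> bool" where
    "K = (\<lambda>(x, y, z). Bit_Operations.xor (Bit_Operations.xor x y) z = 0)"
  have K_x: "K (x, y, z) \<longleftrightarrow> x = Bit_Operations.xor y z" for x y z
    by (simp add: K_def xor.assoc xor_eq_0_iff_nat)
  have K_y: "K (x, y, z) \<longleftrightarrow> y = Bit_Operations.xor x z" for x y z
    unfolding K_x by (metis xor.assoc xor.commute xor.left_neutral xor_self_eq)
  \<comment> \<open>This order of arguments fits the cut lemmas with \<open>x\<close> and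
    \<open>z\<close> exchanged; they serve both directions because \<open>f\<close> is
    symmetric.\<close>
  have K_z: "K (x, y, z) \<longleftrightarrow> z = Bit_Operations.xor y x" for x y z
    by (auto simp: K_def xor_eq_0_iff_nat xor.commute)
  have pos: "(x, y, z) \<in> chocolate_positions f \<longleftrightarrow> y \<le> (x + z) div k" for x y z
    by (simp add: chocolate_positions_def f)
  have stable: "\<not> K q" if "p \<in> chocolate_positions f" "chocolate_move f p q" "K p" for p q
    using that(2,1,3)
  proof cases
    case (cut_x u x y z)
    with that(1,3) cut_leaves_nim_zero[OF k, of y x z u] show ?thesis
      by (simp add: pos K_x f)
  next
    case (cut_y v y x z)
    with that(1,3) show ?thesis by (simp add: K_y)
  next
    case (cut_z w z x y)
    with that(1,3) cut_leaves_nim_zero[OF k, of y z x w] show ?thesis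
      by (simp add: pos K_z f add.commute min.commute)
  qed
  have absorbing: "\<exists>q. chocolate_move f p q \<and> K q" if "p \<in> chocolate_positions f" "\<not> K p" for p
  proof -
    obtain x y z where p: "p = (x, y, z)" by (cases p)
    from nim_reducing_move_exists[of x y z] that(2) p
    consider "Bit_Operations.xor y z < x" | "Bit_Operations.xor x z < y" | "Bit_Operations.xor y x < z"
      by (auto simp: K_def xor.commute[of y x])
    then show ?thesis
    proof cases
      case 1
      with cut_to_nim_zero_exists[OF k, of y x z] that(1) p
      obtain u where "u < x" "K (u, min (f u z) y, z)"
        by (auto simp: pos K_x f)
      with p cut_x show ?thesis by blast
    next
      case 2
      with p cut_y[of "Bit_Operations.xor x z" y f x z] show ?thesis
        by (auto simp: K_y)
    next
      case 3
      with cut_to_nim_zero_exists[OF k, of y z x] that(1) p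
      obtain w where "w < z" "K (x, min y (f x w), w)"
        by (auto simp: pos K_z f add.commute min.commute)
      with p cut_z show ?thesis by blast
    qed
  qed
  have decr: "(\<lambda>(x, y, z). x + y + z) q < (\<lambda>(x, y, z). x + y + z) p"
    if "chocolate_move f p q" for p q
    using that by cases auto
  from P_position_iff_kernel[where K = K, OF chocolate_move_closed decr stable absorbing assms(3)]
  show ?thesis by (simp add: K_def)
qed

end
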